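(* Let $\chi\in(0,1)$, let $d$ be a positive integer, let $\{\bar A_k\}_{k=1}^\infty$ be a sequence of symmetric, positive semidefinite matrices in $\mathbb R^{d\times d}$, let $\{\bar b_k\}_{k=1}^\infty$ be a sequence in $\mathbb R^d$, and let $\{\bar h_k\}_{k=1}^\infty$ be a sequence in $\mathbb R^d$ satisfying $$\bar h_{k+1}=\bar h_k+\frac1{k^\chi}\left(\bar b_k-\bar A_k\bar h_k\right)\qquad\text{for all }k=1,2,\dots$$ Suppose $\gamma\in[0,\chi)$, $h\in\mathbb R^d$, and $A\in\mathbb R^{d\times d}$ is a symmetric positive-definite matrix. (a) If $$\lim_{n\to\infty}\left\|\frac1{n^\chi}\sum_{k=1}^n(\bar A_k-A)\right\|=0\quad\text{and}\quad \lim_{n\to\infty}\left|\frac1{n^{\chi-\gamma}}\sum_{k=1}^n(\bar b_k-\bar A_kh)\right|=0,$$ then $|\bar h_n-h|=o(n^{-\gamma})$ as $n\to\infty$. (b) Conversely, if $\lim_{k\to\infty}\left|k^{1-\chi}(\bar h_k-h)\right|=0$ and $\frac1{n^\chi}\sum_{k=1}^nk^{\chi-1}\|\bar A_k\|$ is bounded in $n$, then $$\lim_{n\to\infty}\left|\frac1{n^\chi}\sum_{k=1}^n(\bar b_k-\bar A_kh)\right|=0.$$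
   Context: All sequences are deterministic. $|x|$ denotes the Euclidean norm of $x\in\mathbb R^d$, and $\|C\|=\sup_{|x|=1}|Cx|$ is the operator norm of a matrix $C$. *)

theory Defs
  imports "HOL-Analysis.Analysis" "HOL-Library.Landau_Symbols"
begin

definition symmetric_mat :: "real ^ 'd ^ 'd \<Rightarrow> bool" where
  "symmetric_mat C \<longleftrightarrow> transpose C = C"

definition sym_pos_semidef :: "real ^ 'd ^ 'd \<Rightarrow> bool" where
  "sym_pos_semidef C \<longleftrightarrow> symmetric_mat C \<and> (\<forall>x. 0 \<le> x \<bullet> (C *v x))"

definition sym_pos_def :: "real ^ 'd ^ 'd \<Rightarrow> bool" where
  "sym_pos_def C \<longleftrightarrow> symmetric_mat C \<and> (\<forall>x. x \<noteq> 0 \<longrightarrow> 0 < x \<bullet> (C *v x))"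

(* The norm of the type real ^ 'd ^ 'd is the Frobenius norm, not the operator norm. *)
definition mat_opnorm :: "real ^ 'd ^ 'd \<Rightarrow> real" where
  "mat_opnorm C = onorm (\<lambda>x. C *v x)"

lemma mat_opnorm_eq_Sup_sphere:
  fixes C :: "real ^ 'd ^ 'd"
  shows "mat_opnorm C = (SUP x\<in>{x. norm x = 1}. norm (C *v x))"
proof -
  let ?S = "(\<lambda>x. norm (C *v x)) ` {x. norm x = 1}"
  have bl: "bounded_linear (\<lambda>x. C *v x)"
    by (rule matrix_vector_mul_bounded_linear)
  have le: "y \<le> mat_opnorm C" if "y \<in> ?S" for y
  proof -
    from that obtain x where x: "y = norm (C *v x)" "norm x = 1"
      by blast
    show ?thesis
      using onorm[OF bl, of x] unfolding x mat_opnorm_def by simp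
  qed
  have bdd: "bdd_above ?S"
    using le by (rule bdd_aboveI)
  have "norm (axis (undefined :: 'd) (1 :: real)) = 1"
    by (rule norm_axis_1)
  then have nonempty: "?S \<noteq> {}"
    by blast
  have "norm (C *v x) \<le> Sup ?S * norm x" for x
  proof (cases "x = 0")
    case True
    then show ?thesis
      by simp
  next
    case False
    then have pos: "norm x > 0"
      by simp
    let ?u = "inverse (norm x) *\<^sub>R x"
    have "norm ?u = 1"
      using pos by simp
    then have "norm (C *v ?u) \<le> Sup ?S"
      by (intro cSup_upper[OF _ bdd] imageI CollectI)
    moreover have "norm (C *v ?u) = norm (C *v x) / norm x"
      by (simp only: matrix_vector_mult_scaleR norm_scaleR abs_inverse abs_norm_cancel)
        (simp only: divide_inverse mult.commute)
    ultimately show ?thesis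
      using pos by (simp only: pos_divide_le_eq)
  qed
  then have "mat_opnorm C \<le> Sup ?S"
    unfolding mat_opnorm_def by (rule onorm_le)
  moreover have "Sup ?S \<le> mat_opnorm C"
    using nonempty le by (rule cSup_least)
  ultimately show ?thesis
    by (rule antisym)
qed

end

theory Submission
  imports Defs "HOL-Real_Asymp.Real_Asymp"
begin

text \<open>
  Put \<open>e\<^sub>k = h\<^sub>k - h\<close> and \<open>c\<^sub>k = b\<^sub>k - A\<^sub>k h\<close>, so that \<open>e\<^sub>k\<^sub>+\<^sub>1 = e\<^sub>k + k\<^sup>-\<^sup>\<chi>(c\<^sub>k - A\<^sub>k e\<^sub>k)\<close>.
  For (a), follow the recursion over a block \<open>n \<le> k < n + \<delta>n\<^sup>\<chi>\<close>, whose total step size \<open>s\<close> lies between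
  \<open>\<delta>/4\<close> and \<open>\<delta>\<close>. Summation by parts turns the averaging hypotheses into \<open>\<Sum>k\<^sup>-\<^sup>\<chi> A\<^sub>k = sA + o(1)\<close> and
  \<open>\<Sum>k\<^sup>-\<^sup>\<chi> c\<^sub>k = o(n\<^sup>-\<^sup>\<gamma>)\<close> over the block. The matrices \<open>A\<^sub>k\<close> need not be bounded, but being positive
  semidefinite they are dominated by their traces, hence \<open>\<Sum>k\<^sup>-\<^sup>\<chi>\<parallel>A\<^sub>k\<parallel> = O(\<delta>)\<close>. So a block multiplies the
  error by \<open>I - sA + O(\<delta>\<^sup>2) + o(1)\<close>, which contracts for small \<open>\<delta>\<close>, and adds \<open>o(n\<^sup>-\<^sup>\<gamma>)\<close>; since
  consecutive block ends have ratio tending to 1, \<open>n\<^sup>\<gamma>|e\<^sub>n|\<close> tends to 0.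
  For (b), solve the recursion for \<open>c\<^sub>k\<close>; both resulting averages are weighted means of null sequences.
\<close>

section \<open>Weighted sums over a block\<close>

text \<open>Abel summation trades the weights for \<open>a k\<close> and the decrements
  \<open>a i - a (Suc i)\<close>. These are nonnegative and add up to \<open>a n\<close>, and each
  multiplies a partial sum of norm at most \<open>D\<close>.\<close>

lemma summation_by_parts_bound:
  fixes a :: "nat \<Rightarrow> real" and c :: "nat \<Rightarrow> 'a::real_normed_vector"
  assumes anti: "\<And>i. n \<le> i \<Longrightarrow> i < k \<Longrightarrow> a (Suc i) \<le> a i"
    and nonneg: "\<And>i. n \<le> i \<Longrightarrow> i \<le> k \<Longrightarrow> 0 \<le> a i"
    and bound: "\<And>j. n \<le> j \<Longrightarrow> j \<le> k \<Longrightarrow> norm (sum c {n..<j}) \<le> D"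
    and "n \<le> k"
  shows "norm (\<Sum>i=n..<k. a i *\<^sub>R c i) \<le> a n * D"
proof -
  have eq: "(\<Sum>i=n..<k. a i *\<^sub>R c i) =
      a k *\<^sub>R sum c {n..<k} + (\<Sum>i=n..<k. (a i - a (Suc i)) *\<^sub>R sum c {n..<Suc i})"
    using \<open>n \<le> k\<close>
  proof (induction k rule: dec_induct)
    case (step k)
    then show ?case by (simp add: scaleR_add_right scaleR_diff_left)
  qed simp
  have "norm (\<Sum>i=n..<k. (a i - a (Suc i)) *\<^sub>R sum c {n..<Suc i}) \<le> (\<Sum>i=n..<k. (a i - a (Suc i)) * D)"
  proof (rule sum_norm_le)
    fix i assume i: "i \<in> {n..<k}"
    then have "norm (sum c {n..<Suc i}) \<le> D" by (intro bound) auto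
    then show "norm ((a i - a (Suc i)) *\<^sub>R sum c {n..<Suc i}) \<le> (a i - a (Suc i)) * D"
      using anti[of i] i by (simp add: mult_left_mono)
  qed
  also have "\<dots> = (a n - a k) * D"
    using sum_Suc_diff'[of n k "\<lambda>i. - a i"] \<open>n \<le> k\<close> by (simp add: sum_distrib_right[symmetric])
  finally have "norm (\<Sum>i=n..<k. (a i - a (Suc i)) *\<^sub>R sum c {n..<Suc i}) \<le> (a n - a k) * D" .
  moreover have "norm (a k *\<^sub>R sum c {n..<k}) \<le> a k * D"
    using nonneg[of k] bound[of k] \<open>n \<le> k\<close> by (simp add: mult_left_mono)
  ultimately show ?thesis
    unfolding eq by (intro norm_triangle_le) (simp add: algebra_simps)
qed

text \<open>A block sum of \<open>c\<close> is a difference of two prefix sums, each of order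
  \<open>\<delta> * n powr (\<alpha> - \<gamma>)\<close> because the block stays below
  \<open>2 * n\<close>; the largest weight divides this by \<open>n powr \<alpha>\<close>.\<close>

lemma block_sum_bound:
  fixes c :: "nat \<Rightarrow> 'a::real_normed_vector"
  assumes partial: "\<And>j. N \<le> j \<Longrightarrow> norm (\<Sum>i=1..j. c i) \<le> \<delta> * real j powr (\<alpha> - \<gamma>)"
    and "0 \<le> \<gamma>" "\<gamma> \<le> \<alpha>" "\<alpha> \<le> 1" "0 \<le> \<delta>"
    and "N < n" "n \<le> k" "k \<le> 2 * n"
  shows "norm (\<Sum>i=n..<k. (1 / real i powr \<alpha>) *\<^sub>R c i) \<le> 4 * \<delta> * real n powr (- \<gamma>)"
proof -
  have n: "n \<ge> 1" using \<open>N < n\<close> by simp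
  define D where "D = 2 * \<delta> * (2 * real n) powr (\<alpha> - \<gamma>)"
  have part: "norm (\<Sum>i=1..j. c i) \<le> \<delta> * (2 * real n) powr (\<alpha> - \<gamma>)" if "N \<le> j" "j \<le> 2 * n" for j
  proof -
    have "real j powr (\<alpha> - \<gamma>) \<le> (2 * real n) powr (\<alpha> - \<gamma>)"
      using that assms by (intro powr_mono2) auto
    then show ?thesis
      using partial[OF that(1)] \<open>0 \<le> \<delta>\<close> by (meson mult_left_mono order_trans)
  qed
  have "norm (\<Sum>i=n..<k. (1 / real i powr \<alpha>) *\<^sub>R c i) \<le> 1 / real n powr \<alpha> * D"
  proof (rule summation_by_parts_bound)
    fix i assume "n \<le> i"
    then show "1 / real (Suc i) powr \<alpha> \<le> 1 / real i powr \<alpha>"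
      using n assms by (intro divide_left_mono powr_mono2) auto
  next
    fix j assume j: "n \<le> j" "j \<le> k"
    \<comment> \<open>The prefixes end at \<open>j - 1\<close> and \<open>n - 1\<close>;
      \<open>N < n\<close> ensures that \<open>partial\<close> applies to the shorter one
      too.\<close>
    have "{1..j - 1} = {1..n - 1} \<union> {n..<j}" using n j by auto
    moreover have disj: "{1..n - 1} \<inter> {n..<j} = {}" by auto
    ultimately have "(\<Sum>i=1..j - 1. c i) = (\<Sum>i=1..n - 1. c i) + sum c {n..<j}"
      by (simp only: sum.union_disjoint[OF finite_atLeastAtMost finite_atLeastLessThan disj])
    then have "sum c {n..<j} = (\<Sum>i=1..j - 1. c i) - (\<Sum>i=1..n - 1. c i)" by simp
    also have "norm \<dots> \<le> \<delta> * (2 * real n) powr (\<alpha> - \<gamma>) + \<delta> * (2 * real n) powr (\<alpha> - \<gamma>)"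
      using j assms by (intro norm_triangle_le_diff add_mono part) auto
    finally show "norm (sum c {n..<j}) \<le> D" by (simp add: D_def)
  qed (use assms in auto)
  also have "\<dots> = 2 * \<delta> * 2 powr (\<alpha> - \<gamma>) * real n powr (- \<gamma>)"
    using n by (simp add: D_def powr_mult powr_diff powr_minus field_simps)
  also have "\<dots> \<le> 2 * \<delta> * 2 * real n powr (- \<gamma>)"
    using powr_mono[of "\<alpha> - \<gamma>" 1 2] assms by (intro mult_right_mono mult_left_mono) auto
  finally show ?thesis by simp
qed

section \<open>The recursion over one block\<close>

text \<open>Unrolled, \<open>e k\<close> is \<open>e n\<close> plus the accumulated drive
  \<open>g\<close> minus the accumulated feedback \<open>B i (e i)\<close>. Total feedback strength
  at most 1/2 keeps \<open>e\<close> bounded; then freezing the argument at \<open>e n\<close> costs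
  only \<open>b\<close> times the drift, which is itself of order
  \<open>b * norm (e n) + d\<close>.\<close>

lemma
  fixes e g :: "nat \<Rightarrow> 'a::real_normed_vector" and B :: "nat \<Rightarrow> 'a \<Rightarrow> 'a"
  assumes step: "\<And>k. n \<le> k \<Longrightarrow> k < m \<Longrightarrow> e (Suc k) = e k + g k - B k (e k)"
    and lin: "\<And>k. n \<le> k \<Longrightarrow> k < m \<Longrightarrow> linear (B k)"
    and B: "\<And>k x. n \<le> k \<Longrightarrow> k < m \<Longrightarrow> norm (B k x) \<le> \<beta> k * norm x"
    and \<beta>: "\<And>k. n \<le> k \<Longrightarrow> k < m \<Longrightarrow> 0 \<le> \<beta> k" "sum \<beta> {n..<m} \<le> b" "b \<le> 1 / 2"
    and g: "\<And>k. n \<le> k \<Longrightarrow> k \<le> m \<Longrightarrow> norm (sum g {n..<k}) \<le> d"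
    and "n \<le> m"
  shows block_growth: "\<And>k. n \<le> k \<Longrightarrow> k \<le> m \<Longrightarrow> norm (e k) \<le> 2 * (norm (e n) + d)"
    and block_linearization:
      "norm (e m - (e n - (\<Sum>k=n..<m. B k (e n)))) \<le> 2 * b\<^sup>2 * norm (e n) + 2 * d"
proof -
  have d: "0 \<le> d" using g[of n] \<open>n \<le> m\<close> by simp
  have "0 \<le> sum \<beta> {n..<m}" using \<beta>(1) by (intro sum_nonneg) auto
  then have b: "0 \<le> b" using \<beta>(2) by linarith
  have sum_\<beta>: "sum \<beta> {n..<k} \<le> b" if "k \<le> m" for k
    using that \<beta> by (intro order_trans[OF sum_mono2 \<beta>(2)]) auto
  have eq: "e k = e n + sum g {n..<k} - (\<Sum>i=n..<k. B i (e i))" if "n \<le> k" "k \<le> m" for k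
    using that by (induction k rule: dec_induct) (simp_all add: step)
  have sum_B: "norm (\<Sum>i=n..<k. B i (x i)) \<le> b * M"
    if k: "k \<le> m" and M: "0 \<le> M" "\<And>i. n \<le> i \<Longrightarrow> i < k \<Longrightarrow> norm (x i) \<le> M" for k x M
  proof -
    have "norm (\<Sum>i=n..<k. B i (x i)) \<le> (\<Sum>i=n..<k. \<beta> i * M)"
    proof (rule sum_norm_le)
      fix i assume i: "i \<in> {n..<k}"
      then have "\<beta> i * norm (x i) \<le> \<beta> i * M"
        using M \<beta> k by (intro mult_left_mono) auto
      then show "norm (B i (x i)) \<le> \<beta> i * M" using B[of i "x i"] i k by fastforce
    qed
    also have "\<dots> \<le> b * M"
      using sum_\<beta>[OF k] M by (simp add: sum_distrib_right[symmetric] mult_right_mono)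
    finally show ?thesis .
  qed
  \<comment> \<open>Strong induction reproduces the bound: the feedback takes at most half of it,
    while \<open>norm (e n)\<close> and the drive fill the other half.\<close>
  show growth: "norm (e k) \<le> 2 * (norm (e n) + d)" if "n \<le> k" "k \<le> m" for k
    using that
  proof (induction k rule: less_induct)
    case (less k)
    have "norm (\<Sum>i=n..<k. B i (e i)) \<le> b * (2 * (norm (e n) + d))"
      using less d by (intro sum_B) auto
    also have "\<dots> \<le> 1 / 2 * (2 * (norm (e n) + d))"
      using d \<beta> by (intro mult_right_mono) auto
    finally have "norm (\<Sum>i=n..<k. B i (e i)) \<le> norm (e n) + d" by simp
    moreover have "norm (e k) \<le> norm (e n) + norm (sum g {n..<k}) + norm (\<Sum>i=n..<k. B i (e i))"
      unfolding eq[OF less.prems] by (intro norm_triangle_le_diff add_right_mono norm_triangle_ineq)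
    ultimately show ?case using g[OF less.prems] by simp
  qed
  \<comment> \<open>\<open>M\<close> bounds the drift away from \<open>e n\<close>; passing it
    through \<open>B\<close> once more yields the second-order factor
    \<open>2 * b\<^sup>2\<close>.\<close>
  define M where "M = d + b * (2 * (norm (e n) + d))"
  have near: "norm (e k - e n) \<le> M" if "n \<le> k" "k \<le> m" for k
  proof -
    have "norm (e k - e n) \<le> norm (sum g {n..<k}) + norm (\<Sum>i=n..<k. B i (e i))"
      unfolding eq[OF that] by (simp add: add_diff_eq[symmetric] norm_triangle_ineq4)
    also have "\<dots> \<le> M"
      unfolding M_def using that growth d by (intro add_mono sum_B g) auto
    finally show ?thesis .
  qed
  have "e m - (e n - (\<Sum>k=n..<m. B k (e n))) = sum g {n..<m} - (\<Sum>k=n..<m. B k (e k - e n))"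
    using lin by (subst eq[OF \<open>n \<le> m\<close> order_refl]) (simp add: linear_diff sum_subtractf)
  also have "norm \<dots> \<le> d + b * M"
  proof (intro norm_triangle_le_diff add_mono)
    have "0 \<le> M" using b d by (simp add: M_def)
    then show "norm (\<Sum>k=n..<m. B k (e k - e n)) \<le> b * M"
      using near by (intro sum_B) auto
  qed (use g \<open>n \<le> m\<close> in auto)
  also have "\<dots> = 2 * b\<^sup>2 * norm (e n) + (1 + b + 2 * b\<^sup>2) * d"
    by (simp add: M_def power2_eq_square algebra_simps)
  also have "\<dots> \<le> 2 * b\<^sup>2 * norm (e n) + 2 * d"
  proof -
    have "b\<^sup>2 \<le> (1 / 2)\<^sup>2" using b \<beta> by (intro power_mono) auto
    then have "1 + b + 2 * b\<^sup>2 \<le> 2" using \<beta>(3) by (simp add: power2_eq_square)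
    then show ?thesis using d by (intro add_left_mono mult_right_mono)
  qed
  finally show "norm (e m - (e n - (\<Sum>k=n..<m. B k (e n)))) \<le> 2 * b\<^sup>2 * norm (e n) + 2 * d" .
qed

section \<open>Two criteria for convergence to zero\<close>

text \<open>Along the iterates of \<open>m\<close> the affine contraction drives \<open>w\<close>
  below roughly \<open>\<epsilon> / (1 - \<rho>)\<close>; the bound with \<open>K\<close> carries
  this to the indices between iterates, and \<epsilon> is arbitrary.\<close>

lemma block_recursion_tendsto_0:
  fixes w :: "nat \<Rightarrow> real" and m :: "nat \<Rightarrow> nat"
  assumes nonneg: "\<And>n. 0 \<le> w n"
    and \<rho>: "0 \<le> \<rho>" "\<rho> < 1" and K: "0 < K"
    and ev: "\<And>\<epsilon>. 0 < \<epsilon> \<Longrightarrow> \<forall>\<^sub>F n in sequentially.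
      n < m n \<and> w (m n) \<le> \<rho> * w n + \<epsilon> \<and> (\<forall>k\<in>{n..m n}. w k \<le> K * (w n + \<epsilon>))"
  shows "w \<longlonglongrightarrow> 0"
proof (rule LIMSEQ_I)
  fix r :: real assume r: "0 < r"
  \<comment> \<open>Chosen so that \<open>\<epsilon> / (1 - \<rho>)\<close> equals
    \<open>r / (4 * K)\<close>: three such terms times \<open>K\<close> stay below
    \<open>r\<close>.\<close>
  define \<epsilon> where "\<epsilon> = r * (1 - \<rho>) / (4 * K)"
  have \<epsilon>: "0 < \<epsilon>" using r \<rho> K by (simp add: \<epsilon>_def)
  obtain N where "\<forall>n\<ge>N. n < m n \<and> w (m n) \<le> \<rho> * w n + \<epsilon> \<and>
      (\<forall>k\<in>{n..m n}. w k \<le> K * (w n + \<epsilon>))"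
    using ev[OF \<epsilon>] unfolding eventually_sequentially by blast
  then have N: "\<And>n. N \<le> n \<Longrightarrow> n < m n"
    "\<And>n. N \<le> n \<Longrightarrow> w (m n) \<le> \<rho> * w n + \<epsilon>"
    "\<And>n k. N \<le> n \<Longrightarrow> n \<le> k \<Longrightarrow> k \<le> m n \<Longrightarrow> w k \<le> K * (w n + \<epsilon>)"
    by simp_all
  define s where "s j = (m ^^ j) N" for j
  have s_ge: "N \<le> s j" for j
    by (induction j) (use N(1) in \<open>force simp: s_def\<close>)+
  have s_less: "s j < s (Suc j)" for j using N(1)[OF s_ge[of j]] by (simp add: s_def)
  then have mono: "strict_mono s" by (simp add: strict_mono_Suc_iff)
  \<comment> \<open>\<open>\<epsilon> / (1 - \<rho>)\<close> is the fixed point of the map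
    \<open>x\<close> to \<open>\<rho> * x + \<epsilon>\<close>.\<close>
  have ws: "w (s j) \<le> \<rho> ^ j * w N + \<epsilon> / (1 - \<rho>)" for j
  proof (induction j)
    case 0
    then show ?case using \<epsilon> \<rho> by (simp add: s_def)
  next
    case (Suc j)
    have "w (s (Suc j)) \<le> \<rho> * w (s j) + \<epsilon>" using N(2)[OF s_ge] by (simp add: s_def)
    also have "\<dots> \<le> \<rho> * (\<rho> ^ j * w N + \<epsilon> / (1 - \<rho>)) + \<epsilon>"
      using Suc \<rho> by (intro add_right_mono mult_left_mono)
    also have "\<dots> = \<rho> ^ Suc j * w N + \<epsilon> / (1 - \<rho>)" using \<rho> by (simp add: field_simps)
    finally show ?case .
  qed
  have "(\<lambda>j. \<rho> ^ j * w N) \<longlonglongrightarrow> 0 * w N"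
    using \<rho> by (intro tendsto_mult LIMSEQ_realpow_zero tendsto_const) auto
  then have "\<forall>\<^sub>F j in sequentially. \<rho> ^ j * w N < \<epsilon>"
    using \<epsilon> by (intro order_tendstoD) auto
  then obtain J where J: "\<And>j. J \<le> j \<Longrightarrow> \<rho> ^ j * w N < \<epsilon>"
    unfolding eventually_sequentially by auto
  have "norm (w k - 0) < r" if k: "s J \<le> k" for k
  proof -
    \<comment> \<open>The last iterate not beyond \<open>k\<close> exists because \<open>s\<close>
      increases strictly; by maximality \<open>k\<close> lies in the block starting there.\<close>
    have fin: "finite {j. s j \<le> k}"
      using mono by (intro finite_subset[OF _ finite_atMost[of k]])
        (auto intro: order_trans[OF strict_mono_imp_increasing])
    define j where "j = Max {j. s j \<le> k}"
    have sj: "s j \<le> k" "J \<le> j"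
      using Max_in[OF fin] Max_ge[OF fin] k by (auto simp: j_def)
    have "\<not> s (Suc j) \<le> k" using Max_ge[OF fin, of "Suc j"] by (auto simp: j_def)
    then have "w k \<le> K * (w (s j) + \<epsilon>)"
      using sj s_ge by (intro N(3)) (auto simp: s_def)
    also have "\<dots> < K * ((\<epsilon> + \<epsilon> / (1 - \<rho>)) + \<epsilon>)"
      using ws[of j] J[OF sj(2)] K by (intro mult_strict_left_mono) auto
    also have "\<dots> \<le> K * (\<epsilon> / (1 - \<rho>) + \<epsilon> / (1 - \<rho>) + \<epsilon> / (1 - \<rho>))"
      using \<epsilon> \<rho> K by (intro mult_left_mono add_mono) (auto simp: field_simps)
    also have "\<dots> = 3 / 4 * r"
    proof -
      have "\<epsilon> / (1 - \<rho>) = r / (4 * K)" using \<rho> by (simp add: \<epsilon>_def)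
      then show ?thesis using K by simp
    qed
    finally show ?thesis using nonneg[of k] r by simp
  qed
  then show "\<exists>no. \<forall>k\<ge>no. norm (w k - 0) < r" by blast
qed

text \<open>A Toeplitz argument: the head up to \<open>N\<close> is a fixed amount \<open>Q\<close>,
  negligible against \<open>P n\<close>, and the tail is at most \<epsilon> times the total weight.
  Each part receives half of \<open>r\<close>.\<close>

lemma weighted_average_tendsto_0:
  fixes w :: "nat \<Rightarrow> real" and x :: "nat \<Rightarrow> 'a::real_normed_vector"
  assumes nonneg: "\<And>k. 1 \<le> k \<Longrightarrow> 0 \<le> w k"
    and bound: "\<And>n. 1 \<le> n \<Longrightarrow> (\<Sum>k=1..n. w k) \<le> M * P n"
    and P: "filterlim P at_top sequentially" and x: "x \<longlonglongrightarrow> 0"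
  shows "(\<lambda>n. (1 / P n) *\<^sub>R (\<Sum>k=1..n. w k *\<^sub>R x k)) \<longlonglongrightarrow> 0"
proof (rule tendstoI)
  fix r :: real assume r: "0 < r"
  \<comment> \<open>\<open>\<bar>M\<bar> + 1\<close> is positive whatever the sign of
    \<open>M\<close>.\<close>
  define \<epsilon> where "\<epsilon> = r / 2 / (\<bar>M\<bar> + 1)"
  have \<epsilon>: "0 < \<epsilon>" using r unfolding \<epsilon>_def by (intro divide_pos_pos) auto
  have "\<epsilon> * M \<le> \<epsilon> * (\<bar>M\<bar> + 1)" using \<epsilon> by (intro mult_left_mono) auto
  also have "\<dots> = r / 2"
  proof -
    have "\<bar>M\<bar> + 1 \<noteq> 0" by linarith
    then show ?thesis unfolding \<epsilon>_def by (rule nonzero_eq_divide_eq[THEN iffD1, OF _ refl])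
  qed
  finally have \<epsilon>M: "\<epsilon> * M \<le> r / 2" .
  have "\<forall>\<^sub>F k in sequentially. norm (x k) < \<epsilon>"
    using x \<epsilon> by (metis order_tendstoD(2) tendsto_norm_zero)
  then obtain N where N: "\<And>k. N \<le> k \<Longrightarrow> norm (x k) < \<epsilon>"
    unfolding eventually_sequentially by auto
  define Q where "Q = (\<Sum>k=1..N. w k * norm (x k))"
  have Q: "0 \<le> Q" unfolding Q_def by (intro sum_nonneg mult_nonneg_nonneg nonneg) auto
  have "\<forall>\<^sub>F n in sequentially. 2 * Q / r < P n"
    using P unfolding filterlim_at_top_dense by blast
  moreover have "\<forall>\<^sub>F n in sequentially. 0 < P n" using P unfolding filterlim_at_top_dense by blast
  ultimately show "\<forall>\<^sub>F n in sequentially. dist ((1 / P n) *\<^sub>R (\<Sum>k=1..n. w k *\<^sub>R x k)) 0 < r"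
    using eventually_ge_at_top[of "Suc N"]
  proof eventually_elim
    case (elim n)
    have "norm (\<Sum>k=1..n. w k *\<^sub>R x k) \<le> (\<Sum>k=1..n. w k * norm (x k))"
      using nonneg by (intro sum_norm_le) auto
    also have "\<dots> = Q + (\<Sum>k=Suc N..n. w k * norm (x k))"
      unfolding Q_def using elim sum.ub_add_nat[of 1 N "\<lambda>k. w k * norm (x k)" "n - N"] by simp
    also have "(\<Sum>k=Suc N..n. w k * norm (x k)) \<le> (\<Sum>k=Suc N..n. w k * \<epsilon>)"
      using N nonneg by (intro sum_mono mult_left_mono) (auto intro: less_imp_le)
    also have "\<dots> \<le> (\<Sum>k=1..n. w k * \<epsilon>)"
      using nonneg \<epsilon> by (intro sum_mono2) auto
    also have "\<dots> \<le> M * P n * \<epsilon>"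
      using bound[of n] elim \<epsilon> by (simp add: sum_distrib_right[symmetric] mult_right_mono)
    also have "\<dots> \<le> r / 2 * P n"
      using mult_right_mono[OF \<epsilon>M, of "P n"] elim by (simp add: mult_ac)
    finally have "norm (\<Sum>k=1..n. w k *\<^sub>R x k) \<le> Q + r / 2 * P n" by simp
    also have "\<dots> < r * P n" using elim r by (simp add: field_simps)
    finally show ?case using elim by (simp add: field_simps)
  qed
qed

section \<open>Operator norm, trace and definite matrices\<close>

lemma norm_mult_le_mat_opnorm: "norm (C *v x) \<le> mat_opnorm C * norm x"
  unfolding mat_opnorm_def by (rule onorm) (rule matrix_vector_mul_bounded_linear)

lemma mat_opnorm_nonneg: "0 \<le> mat_opnorm C"
  unfolding mat_opnorm_def by (rule onorm_pos_le) (rule matrix_vector_mul_bounded_linear)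

lemma mat_opnorm_scaleR: "mat_opnorm (c *\<^sub>R C) = \<bar>c\<bar> * mat_opnorm C"
proof -
  have "(\<lambda>x. (c *\<^sub>R C) *v x) = (\<lambda>x. c *\<^sub>R (C *v x))"
    by (simp only: scaleR_matrix_vector_assoc)
  then show ?thesis
    unfolding mat_opnorm_def by (simp only: onorm_scaleR[OF matrix_vector_mul_bounded_linear])
qed

text \<open>Used to pass from averaged matrices to averaged traces, which are scalars.\<close>

lemma abs_trace_le_mat_opnorm:
  fixes C :: "real ^ 'd ^ 'd"
  shows "\<bar>trace C\<bar> \<le> real CARD('d) * mat_opnorm C"
proof -
  have "\<bar>trace C\<bar> \<le> (\<Sum>i\<in>UNIV. \<bar>C $ i $ i\<bar>)" unfolding trace_def by (rule sum_abs)
  also have "\<dots> \<le> (\<Sum>i\<in>(UNIV::'d set). mat_opnorm C)"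
    unfolding mat_opnorm_def by (intro sum_mono matrix_component_le_onorm)
  finally show ?thesis by simp
qed

text \<open>Testing the form on sums and differences of basis vectors bounds every entry by the
  trace. Since the trace is linear, a sum of norms becomes controllable by the trace of the sum,
  which the averaging hypothesis does control.\<close>

lemma
  fixes C :: "real ^ 'd ^ 'd"
  assumes C: "sym_pos_semidef C"
  shows trace_nonneg_psd: "0 \<le> trace C"
    and mat_opnorm_le_trace_psd: "mat_opnorm C \<le> real CARD('d) * real CARD('d) * trace C"
proof -
  have psd: "0 \<le> x \<bullet> (C *v x)" for x using C by (simp add: sym_pos_semidef_def)
  have ent: "axis i 1 \<bullet> (C *v axis j 1) = C $ i $ j" for i j
    by (simp add: matrix_vector_mult_basis inner_axis' column_def)
  have sym: "C $ i $ j = C $ j $ i" for i j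
  proof -
    have "C $ i $ j = transpose C $ j $ i" by (simp add: transpose_def)
    then show ?thesis using C by (simp add: sym_pos_semidef_def symmetric_mat_def)
  qed
  have diag: "0 \<le> C $ i $ i" for i using psd[of "axis i 1"] unfolding ent .
  show "0 \<le> trace C" unfolding trace_def by (intro sum_nonneg diag)
  have le: "C $ i $ i \<le> trace C" for i
    unfolding trace_def by (intro member_le_sum diag) auto
  have "\<bar>C $ i $ j\<bar> \<le> trace C" for i j
  proof -
    let ?u = "axis i 1 :: real ^ 'd" and ?v = "axis j 1 :: real ^ 'd"
    have "(?u + ?v) \<bullet> (C *v (?u + ?v)) = C $ i $ i + C $ j $ j + 2 * C $ i $ j"
      unfolding matrix_vector_right_distrib inner_add_left inner_add_right ent using sym[of i j] by linarith
    then have "0 \<le> C $ i $ i + C $ j $ j + 2 * C $ i $ j"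
      using psd[of "?u + ?v"] by linarith
    moreover have "(?u - ?v) \<bullet> (C *v (?u - ?v)) = C $ i $ i + C $ j $ j - 2 * C $ i $ j"
      unfolding matrix_vector_mult_diff_distrib inner_diff_left inner_diff_right ent using sym[of i j] by linarith
    then have "0 \<le> C $ i $ i + C $ j $ j - 2 * C $ i $ j"
      using psd[of "?u - ?v"] by linarith
    ultimately show ?thesis using le[of i] le[of j] by linarith
  qed
  then show "mat_opnorm C \<le> real CARD('d) * real CARD('d) * trace C"
    unfolding mat_opnorm_def by (rule onorm_le_matrix_component)
qed

text \<open>\<mu> is the minimum of the quadratic form on the compact unit sphere; homogeneity
  extends the bound to all vectors.\<close>

lemma pos_def_coercive:
  fixes A :: "real ^ 'd ^ 'd"
  assumes "sym_pos_def A"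
  obtains \<mu> where "0 < \<mu>" "\<And>x. \<mu> * (norm x)\<^sup>2 \<le> x \<bullet> (A *v x)"
proof -
  let ?q = "\<lambda>x. x \<bullet> (A *v x)"
  have "continuous_on (sphere 0 1) ?q"
    by (intro continuous_intros linear_continuous_on matrix_vector_mul_bounded_linear)
  moreover have "norm (axis (undefined :: 'd) (1 :: real)) = 1" by (rule norm_axis_1)
  then have "axis (undefined :: 'd) 1 \<in> sphere (0 :: real ^ 'd) 1" by simp
  then have "sphere (0 :: real ^ 'd) 1 \<noteq> {}" by blast
  ultimately have "\<exists>u\<in>sphere 0 1. \<forall>x\<in>sphere 0 1. ?q u \<le> ?q x"
    by (intro continuous_attains_inf compact_sphere)
  then obtain u where u: "u \<in> sphere 0 1" "\<And>x. x \<in> sphere 0 1 \<Longrightarrow> ?q u \<le> ?q x"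
    by blast
  show thesis
  proof
    have "u \<noteq> 0" using u(1) by auto
    then show "0 < ?q u" using assms by (simp add: sym_pos_def_def)
    show "?q u * (norm x)\<^sup>2 \<le> ?q x" for x
    proof (cases "x = 0")
      case False
      have "?q u \<le> ?q (x /\<^sub>R norm x)" using False by (intro u) auto
      also have "\<dots> = ?q x / (norm x)\<^sup>2"
        by (simp add: matrix_vector_mult_scaleR power2_eq_square divide_inverse)
      finally show ?thesis using False by (simp add: field_simps)
    qed simp
  qed
qed

text \<open>In the expanded square, half of the gain \<open>2 * s * \<mu>\<close> absorbs the
  quadratic term. What remains, \<open>1 - s * \<mu>\<close>, is at most the square of
  \<open>1 - s * \<mu> / 2\<close>, and \<open>s * \<mu> \<le> 2\<close> permits taking the
  root.\<close>

lemma gradient_step_contraction: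
  fixes A :: "real ^ 'd ^ 'd"
  assumes coercive: "\<mu> * (norm x)\<^sup>2 \<le> x \<bullet> (A *v x)"
    and s: "0 \<le> s" "s * (mat_opnorm A)\<^sup>2 \<le> \<mu>" "s * \<mu> \<le> 2"
  shows "norm (x - s *\<^sub>R (A *v x)) \<le> (1 - s * \<mu> / 2) * norm x"
proof (rule power2_le_imp_le)
  have "(norm (x - s *\<^sub>R (A *v x)))\<^sup>2 = (norm x)\<^sup>2 - 2 * s * (x \<bullet> (A *v x)) + s\<^sup>2 * (norm (A *v x))\<^sup>2"
    unfolding power2_norm_eq_inner
    by (simp add: inner_diff_left inner_diff_right inner_commute[of "A *v x" x] power2_eq_square right_diff_distrib)
  also have "\<dots> \<le> (norm x)\<^sup>2 - 2 * s * (\<mu> * (norm x)\<^sup>2) + s * \<mu> * (norm x)\<^sup>2"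
  proof (intro add_mono diff_left_mono mult_left_mono)
    have "s\<^sup>2 * (norm (A *v x))\<^sup>2 \<le> s\<^sup>2 * (mat_opnorm A * norm x)\<^sup>2"
      by (intro mult_left_mono power_mono norm_mult_le_mat_opnorm) auto
    also have "\<dots> = s * (s * (mat_opnorm A)\<^sup>2) * (norm x)\<^sup>2" by (simp add: power2_eq_square)
    also have "\<dots> \<le> s * \<mu> * (norm x)\<^sup>2" using s by (intro mult_right_mono mult_left_mono) auto
    finally show "s\<^sup>2 * (norm (A *v x))\<^sup>2 \<le> s * \<mu> * (norm x)\<^sup>2" .
  qed (use coercive s in auto)
  also have "\<dots> = (1 - s * \<mu>) * (norm x)\<^sup>2" by (simp add: left_diff_distrib)
  also have "\<dots> \<le> (1 - s * \<mu> / 2)\<^sup>2 * (norm x)\<^sup>2"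
  proof (rule mult_right_mono)
    have "(1 - s * \<mu> / 2)\<^sup>2 = 1 - s * \<mu> + (s * \<mu> / 2)\<^sup>2" by (simp add: power2_diff)
    then show "1 - s * \<mu> \<le> (1 - s * \<mu> / 2)\<^sup>2" by simp
  qed simp
  finally show "(norm (x - s *\<^sub>R (A *v x)))\<^sup>2 \<le> ((1 - s * \<mu> / 2) * norm x)\<^sup>2"
    by (simp add: power_mult_distrib)
  show "0 \<le> (1 - s * \<mu> / 2) * norm x" using s by simp
qed

section \<open>Length and total step size of a block\<close>

text \<open>The block has about \<open>c * n powr \<alpha>\<close> steps, each between
  \<open>1 / (2 * n powr \<alpha>)\<close> and \<open>1 / n powr \<alpha>\<close>. As \<alpha> is
  below 1, its length is negligible against \<open>n\<close>.\<close>

lemma step_size_block: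
  fixes \<alpha> c \<eta> :: real
  assumes \<alpha>: "0 < \<alpha>" "\<alpha> < 1" and c: "0 < c" "c \<le> 1" and \<eta>: "0 < \<eta>"
  defines "m \<equiv> \<lambda>n. n + nat \<lfloor>c * real n powr \<alpha>\<rfloor>"
  shows "\<forall>\<^sub>F n in sequentially. n < m n \<and> m n \<le> 2 * n \<and> real (m n) \<le> (1 + \<eta>) * real n \<and>
    c / 4 \<le> (\<Sum>i=n..<m n. 1 / real i powr \<alpha>) \<and> (\<Sum>i=n..<m n. 1 / real i powr \<alpha>) \<le> c"
proof -
  have "filterlim (\<lambda>n. real n powr \<alpha>) at_top sequentially" using \<alpha> by real_asymp
  \<comment> \<open>Makes \<open>c * n powr \<alpha>\<close> exceed 2, so rounding down loses at
    most half of it.\<close>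
  then have "\<forall>\<^sub>F n in sequentially. 2 / c < real n powr \<alpha>" unfolding filterlim_at_top_dense by blast
  moreover have "(\<lambda>n. real n powr \<alpha> / real n) \<longlonglongrightarrow> 0" using \<alpha> by real_asymp
  then have "\<forall>\<^sub>F n in sequentially. real n powr \<alpha> / real n < \<eta>" using \<eta> by (rule order_tendstoD(2))
  ultimately show ?thesis using eventually_ge_at_top[of 1]
  proof eventually_elim
    case (elim n)
    then have n: "0 < real n" by simp
    define l where "l = nat \<lfloor>c * real n powr \<alpha>\<rfloor>"
    have m: "m n = n + l" by (simp add: m_def l_def)
    have p: "0 < real n powr \<alpha>" using n by simp
    have big: "2 < c * real n powr \<alpha>" using elim(1) c by (simp add: field_simps)
    have l: "c * real n powr \<alpha> - 1 \<le> real l" "real l \<le> c * real n powr \<alpha>"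
      using big unfolding l_def by linarith+
    have l_le: "real l \<le> real n powr \<alpha>"
      using mult_right_mono[OF c(2), of "real n powr \<alpha>"] l(2) by simp
    also have "\<dots> \<le> real n powr 1" using elim(3) \<alpha> by (intro powr_mono) auto
    finally have "l \<le> n" using n by simp
    moreover have "real l \<le> \<eta> * real n"
      using l_le elim(2) n by (simp add: divide_less_eq)
    moreover have "(\<Sum>i=n..<n + l. 1 / real i powr \<alpha>) \<le> c"
    proof -
      have "(\<Sum>i=n..<n + l. 1 / real i powr \<alpha>) \<le> (\<Sum>i=n..<n + l. 1 / real n powr \<alpha>)"
        using n \<alpha> by (intro sum_mono divide_left_mono powr_mono2) auto
      also have "\<dots> = real l / real n powr \<alpha>" by simp
      also have "\<dots> \<le> c" using l(2) p by (simp add: divide_le_eq)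
      finally show ?thesis .
    qed
    moreover have "c / 4 \<le> (\<Sum>i=n..<n + l. 1 / real i powr \<alpha>)"
    proof -
      \<comment> \<open>One half is lost to rounding, the other to indices below
        \<open>2 * n\<close>, whose step sizes may be half as large.\<close>
      have "c / 4 = c * real n powr \<alpha> / 2 * (1 / (2 * real n powr \<alpha>))" using p by simp
      also have "\<dots> \<le> real l * (1 / (2 * real n powr \<alpha>))"
        using l(1) big p by (intro mult_right_mono) auto
      also have "\<dots> = (\<Sum>i=n..<n + l. 1 / (2 * real n powr \<alpha>))" by simp
      also have "\<dots> \<le> (\<Sum>i=n..<n + l. 1 / real i powr \<alpha>)"
      proof (intro sum_mono divide_left_mono)
        fix i assume i: "i \<in> {n..<n + l}"
        then have "real i powr \<alpha> \<le> (2 * real n) powr \<alpha>"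
          using \<open>l \<le> n\<close> \<alpha> by (intro powr_mono2) auto
        also have "\<dots> = 2 powr \<alpha> * real n powr \<alpha>" by (simp add: powr_mult)
        also have "\<dots> \<le> 2 * real n powr \<alpha>"
          using powr_mono[of \<alpha> 1 2] \<alpha> by (intro mult_right_mono) auto
        finally show "real i powr \<alpha> \<le> 2 * real n powr \<alpha>" .
        show "0 < 2 * real n powr \<alpha> * real i powr \<alpha>" using i n by simp
      qed simp
      finally show ?thesis .
    qed
    moreover have "0 < l" using l(1) big by linarith
    ultimately show ?case unfolding m by (simp add: distrib_right)
  qed
qed

lemma sum_matrix_vector_mult: "(\<Sum>i\<in>I. f i) *v x = (\<Sum>i\<in>I. f i *v x)"
  by (induction I rule: infinite_finite_induct) (simp_all add: matrix_vector_mult_add_rdistrib)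

lemma trace_sum: "trace (\<Sum>i\<in>I. f i) = (\<Sum>i\<in>I. trace (f i))"
  unfolding trace_def sum_component by (rule sum.swap)

lemma eventually_le_of_scaled_tendsto_0:
  fixes f :: "nat \<Rightarrow> real"
  assumes "(\<lambda>n. 1 / real n powr p * f n) \<longlonglongrightarrow> 0" "0 < \<delta>"
  obtains N where "1 \<le> N" "\<And>n. N \<le> n \<Longrightarrow> f n \<le> \<delta> * real n powr p"
proof -
  have "\<forall>\<^sub>F n in sequentially. 1 / real n powr p * f n < \<delta>"
    using assms by (rule order_tendstoD(2))
  then obtain N where N: "\<And>n. N \<le> n \<Longrightarrow> 1 / real n powr p * f n < \<delta>"
    unfolding eventually_sequentially by blast
  show thesis
  \<comment> \<open>At index 0 the quotient is 0 by convention and says nothing about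
    \<open>f\<close>.\<close>
  proof (rule that[of "max 1 N"])
    fix n assume "max 1 N \<le> n"
    then show "f n \<le> \<delta> * real n powr p"
      using N[of n] by (simp add: divide_less_eq less_imp_le)
  qed simp
qed

section \<open>From the rate of the iterates to the averages: part (b)\<close>

lemma averaged_driving_term_tendsto_0:
  fixes e c :: "nat \<Rightarrow> real ^ 'd" and A :: "nat \<Rightarrow> real ^ 'd ^ 'd"
  assumes \<alpha>: "0 < \<alpha>" "\<alpha> < 1"
    and step: "\<And>k. 1 \<le> k \<Longrightarrow> e (Suc k) = e k + (1 / real k powr \<alpha>) *\<^sub>R (c k - A k *v e k)"
    and e: "(\<lambda>k. real k powr (1 - \<alpha>) * norm (e k)) \<longlonglongrightarrow> 0"
    and bounded: "bounded ((\<lambda>n. (1 / real n powr \<alpha>) *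
      (\<Sum>k=1..n. real k powr (\<alpha> - 1) * mat_opnorm (A k))) ` {1..})"
  shows "(\<lambda>n. (1 / real n powr \<alpha>) *\<^sub>R (\<Sum>k=1..n. c k)) \<longlonglongrightarrow> 0"
proof -
  let ?P = "\<lambda>n. real n powr \<alpha>"
  have P: "filterlim ?P at_top sequentially" using \<alpha> by real_asymp
  have "\<forall>\<^sub>F k in sequentially. norm (e k) \<le> real k powr (1 - \<alpha>) * norm (e k)"
    using eventually_ge_at_top[of 1]
  proof eventually_elim
    case (elim k)
    then have "1 * norm (e k) \<le> real k powr (1 - \<alpha>) * norm (e k)"
      using \<alpha> by (intro mult_right_mono ge_one_powr_ge_zero) auto
    then show ?case by simp
  qed
  then have e0: "e \<longlonglongrightarrow> 0" using e by (rule Lim_null_comparison)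
  \<comment> \<open>Increments of \<open>k powr \<alpha>\<close>, produced by summation by parts in
    \<open>sum_c\<close>; \<open>0 powr \<alpha> = 0\<close> makes their total exactly
    \<open>n powr \<alpha>\<close>.\<close>
  define w where "w k = real k powr \<alpha> - (real k - 1) powr \<alpha>" for k :: nat
  have w0: "0 \<le> w k" if "1 \<le> k" for k
    unfolding w_def using that \<alpha> powr_mono2[of \<alpha> "real k - 1" "real k"] by simp
  have sum_w: "(\<Sum>k=1..n. w k) = ?P n" for n
    using \<alpha> by (induction n) (simp_all add: w_def)
  have W: "(\<lambda>n. (1 / ?P n) *\<^sub>R (\<Sum>k=1..n. w k *\<^sub>R e k)) \<longlonglongrightarrow> 0"
    by (rule weighted_average_tendsto_0[where M = 1]) (use w0 sum_w P e0 in auto)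
  obtain M where M: "\<And>n. 1 \<le> n \<Longrightarrow>
      \<bar>(1 / ?P n) * (\<Sum>k=1..n. real k powr (\<alpha> - 1) * mat_opnorm (A k))\<bar> \<le> M"
    using bounded unfolding bounded_iff by auto
  \<comment> \<open>The factors \<open>k powr (\<alpha> - 1)\<close> and
    \<open>k powr (1 - \<alpha>)\<close> cancel: one belongs to the weights of bounded average, the
    other to the null sequence.\<close>
  have V: "(\<lambda>n. (1 / ?P n) *\<^sub>R (\<Sum>k=1..n. (real k powr (\<alpha> - 1) * mat_opnorm (A k)) *\<^sub>R
      (real k powr (1 - \<alpha>) * norm (e k)))) \<longlonglongrightarrow> 0"
  proof (rule weighted_average_tendsto_0[where M = M])
    fix n :: nat assume "1 \<le> n"
    then show "(\<Sum>k=1..n. real k powr (\<alpha> - 1) * mat_opnorm (A k)) \<le> M * ?P n"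
      using M[of n] by (simp add: divide_le_eq)
  qed (use P e in \<open>auto intro: mult_nonneg_nonneg mat_opnorm_nonneg\<close>)
  have "norm ((1 / ?P n) *\<^sub>R (\<Sum>k=1..n. A k *v e k)) \<le>
      (1 / ?P n) *\<^sub>R (\<Sum>k=1..n. (real k powr (\<alpha> - 1) * mat_opnorm (A k)) *\<^sub>R
      (real k powr (1 - \<alpha>) * norm (e k)))" for n
  proof -
    have "norm (\<Sum>k=1..n. A k *v e k) \<le> (\<Sum>k=1..n. (real k powr (\<alpha> - 1) * mat_opnorm (A k)) *\<^sub>R
      (real k powr (1 - \<alpha>) * norm (e k)))"
    proof (rule sum_norm_le)
      fix k assume k: "k \<in> {1..n}"
      then have "real k powr (\<alpha> - 1) * real k powr (1 - \<alpha>) = 1"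
        by (simp add: powr_add[symmetric])
      then have "(real k powr (\<alpha> - 1) * mat_opnorm (A k)) *\<^sub>R (real k powr (1 - \<alpha>) * norm (e k)) =
          mat_opnorm (A k) * norm (e k)"
        by (metis mult.assoc mult.commute mult_1 real_scaleR_def)
      then show "norm (A k *v e k) \<le> (real k powr (\<alpha> - 1) * mat_opnorm (A k)) *\<^sub>R
          (real k powr (1 - \<alpha>) * norm (e k))"
        using norm_mult_le_mat_opnorm[of "A k" "e k"] by (simp only:)
    qed
    then show ?thesis by (simp add: divide_right_mono)
  qed
  then have AE: "(\<lambda>n. (1 / ?P n) *\<^sub>R (\<Sum>k=1..n. A k *v e k)) \<longlonglongrightarrow> 0"
    by (intro Lim_null_comparison[OF _ V] always_eventually allI)
  have sum_c: "(\<Sum>k=1..n. c k) = ?P n *\<^sub>R e (Suc n) - (\<Sum>k=1..n. w k *\<^sub>R e k) + (\<Sum>k=1..n. A k *v e k)" for n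
  proof (induction n)
    case (Suc n)
    have "c (Suc n) = ?P (Suc n) *\<^sub>R (e (Suc (Suc n)) - e (Suc n)) + A (Suc n) *v e (Suc n)"
      by (simp add: step[of "Suc n"])
    moreover have "w (Suc n) = ?P (Suc n) - ?P n" by (simp add: w_def)
    ultimately show ?case
      using Suc by (simp add: scaleR_diff_left scaleR_diff_right)
  qed simp
  have "(\<lambda>n. e (Suc n) - (1 / ?P n) *\<^sub>R (\<Sum>k=1..n. w k *\<^sub>R e k) + (1 / ?P n) *\<^sub>R (\<Sum>k=1..n. A k *v e k))
      \<longlonglongrightarrow> 0 - 0 + 0"
    by (intro tendsto_intros W AE LIMSEQ_Suc e0)
  moreover have "\<forall>\<^sub>F n in sequentially. e (Suc n) - (1 / ?P n) *\<^sub>R (\<Sum>k=1..n. w k *\<^sub>R e k) +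
      (1 / ?P n) *\<^sub>R (\<Sum>k=1..n. A k *v e k) = (1 / ?P n) *\<^sub>R (\<Sum>k=1..n. c k)"
    using eventually_ge_at_top[of 1]
    by eventually_elim (simp only: sum_c scaleR_add_right scaleR_diff_right scaleR_scaleR, simp)
  ultimately show ?thesis by (simp add: Lim_transform_eventually)
qed

section \<open>From the averages to the rate of the iterates: part (a)\<close>

text \<open>The constants are fixed in order: \<delta> from \<open>A\<close> and the dimension, then
  \<rho> and \<nu> from \<delta>, and only the threshold \<open>N2\<close> for the drive depends on
  \<epsilon>. Hence the blocks and their contraction factor are the same for every
  \<epsilon>.\<close>

lemma stochastic_approximation_rate:
  fixes e c :: "nat \<Rightarrow> real ^ 'd" and B :: "nat \<Rightarrow> real ^ 'd ^ 'd" and A :: "real ^ 'd ^ 'd"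
  assumes \<alpha>: "0 < \<alpha>" "\<alpha> < 1" and \<gamma>: "0 \<le> \<gamma>" "\<gamma> < \<alpha>"
    and psd: "\<And>k. 1 \<le> k \<Longrightarrow> sym_pos_semidef (B k)" and pd: "sym_pos_def A"
    and step: "\<And>k. 1 \<le> k \<Longrightarrow> e (Suc k) = e k + (1 / real k powr \<alpha>) *\<^sub>R (c k - B k *v e k)"
    and limB: "(\<lambda>n. 1 / real n powr \<alpha> * mat_opnorm (\<Sum>k=1..n. B k - A)) \<longlonglongrightarrow> 0"
    and limc: "(\<lambda>n. 1 / real n powr (\<alpha> - \<gamma>) * norm (\<Sum>k=1..n. c k)) \<longlonglongrightarrow> 0"
  shows "(\<lambda>n. real n powr \<gamma> * norm (e n)) \<longlonglongrightarrow> 0"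
proof -
  obtain \<mu> where \<mu>: "0 < \<mu>" "\<And>x. \<mu> * (norm x)\<^sup>2 \<le> x \<bullet> (A *v x)"
    using pos_def_coercive[OF pd] by blast
  define a where "a = mat_opnorm A"
  define D where "D = real CARD('d)"
  have D: "1 \<le> D" by (simp add: D_def Suc_le_eq)
  have a: "0 \<le> a" unfolding a_def by (rule mat_opnorm_nonneg)
  \<comment> \<open>\<open>K * \<delta>\<close> will bound the feedback of a block:
    \<open>D * D\<close> comes from dominating norms by traces, \<open>D * a\<close> bounds
    \<open>trace A\<close>, and 1 covers the averaging error.\<close>
  define K where "K = D * D * (D * a + 1)"
  have K: "0 < K" using D a by (simp add: K_def add_nonneg_pos)
  \<comment> \<open>\<open>1 / S\<close> is small enough for the linear gain \<open>\<delta>\<mu> / 8\<close> of a block to dominate the quadratic error \<open>2(K\<delta>)\<^sup>2\<close>.\<close>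
  define S where "S = 1 + 2 * K + a\<^sup>2 / \<mu> + \<mu> + 64 * K\<^sup>2 / \<mu>"
  define \<delta> where "\<delta> = 1 / S"
  have S: "1 \<le> S" "2 * K \<le> S" "a\<^sup>2 / \<mu> \<le> S" "\<mu> \<le> S" "64 * K\<^sup>2 / \<mu> \<le> S"
    using K \<mu>(1) by (simp_all add: S_def)
  have \<delta>: "0 < \<delta>" "\<delta> \<le> 1" "K * \<delta> \<le> 1 / 2" "\<delta> * a\<^sup>2 \<le> \<mu>" "\<delta> * \<mu> \<le> 1" "64 * K\<^sup>2 * \<delta> \<le> \<mu>"
    using S \<mu>(1) by (simp_all add: \<delta>_def divide_le_eq mult.commute)
  define m where "m n = n + nat \<lfloor>\<delta> * real n powr \<alpha>\<rfloor>" for n :: nat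
  \<comment> \<open>The contraction gains \<open>\<delta> * \<mu> / 8\<close>; the quadratic error
    and the averaging error each take back \<open>\<delta> * \<mu> / 32\<close>.\<close>
  define \<rho> where "\<rho> = 1 - \<delta> * \<mu> / 16"
  have \<delta>\<mu>: "0 < \<delta> * \<mu>" using \<delta>(1) \<mu>(1) by simp
  have \<rho>: "0 < \<rho>" "\<rho> < 1" using \<delta>(5) \<delta>\<mu> by (simp_all add: \<rho>_def)
  \<comment> \<open>The first entry limits the averaging error \<open>R\<close>, the second the
    error in the traces.\<close>
  define \<nu> where "\<nu> = min (\<delta> * \<mu> / 128) (\<delta> / (4 * D))"
  have \<nu>: "0 < \<nu>" "4 * \<nu> \<le> \<delta> * \<mu> / 32" "4 * (D * \<nu>) \<le> \<delta>"
    using \<delta>\<mu> \<delta>(1) D by (auto simp: \<nu>_def min_def field_simps)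
  obtain N1 where N1: "1 \<le> N1" "\<And>n. N1 \<le> n \<Longrightarrow> mat_opnorm (\<Sum>k=1..n. B k - A) \<le> \<nu> * real n powr \<alpha>"
    using eventually_le_of_scaled_tendsto_0[OF limB \<nu>(1)] by blast
  show ?thesis
  \<comment> \<open>The gap between \<rho> and \<open>(1 + \<rho>) / 2\<close> leaves room for the
    growth of \<open>n powr \<gamma>\<close> over a block. The 4 combines a factor 2 from
    \<open>growth\<close> with a factor 2 from that power.\<close>
  proof (rule block_recursion_tendsto_0[where m = m and \<rho> = "(1 + \<rho>) / 2" and K = 4])
    fix \<epsilon> :: real assume \<epsilon>: "0 < \<epsilon>"
    obtain N2 where N2: "1 \<le> N2" "\<And>n. N2 \<le> n \<Longrightarrow> norm (\<Sum>k=1..n. c k) \<le> \<epsilon> / 16 * real n powr (\<alpha> - \<gamma>)"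
      using eventually_le_of_scaled_tendsto_0[OF limc, of "\<epsilon> / 16"] \<epsilon> by auto
    have "0 < (1 - \<rho>) / 2" using \<rho> by simp
    from step_size_block[OF \<alpha> \<delta>(1,2) this]
    show "\<forall>\<^sub>F n in sequentially. n < m n \<and>
        real (m n) powr \<gamma> * norm (e (m n)) \<le> (1 + \<rho>) / 2 * (real n powr \<gamma> * norm (e n)) + \<epsilon> \<and>
        (\<forall>k\<in>{n..m n}. real k powr \<gamma> * norm (e k) \<le> 4 * (real n powr \<gamma> * norm (e n) + \<epsilon>))"
      using eventually_gt_at_top[of "max N1 N2"] unfolding m_def[symmetric]
    proof eventually_elim
      case (elim n)
      define s where "s = (\<Sum>i=n..<m n. 1 / real i powr \<alpha>)"
      have n: "1 \<le> n" "N1 < n" "N2 < n" using elim(2) N1(1) by auto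
      have m: "n < m n" "m n \<le> 2 * n" "real (m n) \<le> (1 + (1 - \<rho>) / 2) * real n"
        and s: "\<delta> / 4 \<le> s" "s \<le> \<delta>"
        using elim(1) by (simp_all add: s_def)
      \<comment> \<open>Four times \<open>\<epsilon> / 16\<close>, as \<open>block_sum_bound\<close>
        delivers; doubled by the linearization and again by \<open>ratio2\<close>, it adds exactly
        \<epsilon>.\<close>
      define d where "d = \<epsilon> / 4 * real n powr (- \<gamma>)"
      \<comment> \<open>\<open>R\<close> is the error of replacing the block's weighted matrices by
        \<open>s\<close> times \<open>A\<close>; it is bounded through
        \<open>block_sum_bound\<close> with \<gamma> set to 0.\<close>
      define R where "R x = (\<Sum>i=n..<m n. (1 / real i powr \<alpha>) *\<^sub>R ((B i - A) *v x))" for x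
      have R: "norm (R x) \<le> \<delta> * \<mu> / 32 * norm x" for x
      proof -
        have "norm (R x) \<le> 4 * (\<nu> * norm x) * real n powr (- 0)"
          unfolding R_def
        proof (rule block_sum_bound[where N = N1])
          fix j assume "N1 \<le> j"
          then have "mat_opnorm (\<Sum>k=1..j. B k - A) * norm x \<le> \<nu> * real j powr \<alpha> * norm x"
            by (intro mult_right_mono N1) auto
          then show "norm (\<Sum>i=1..j. (B i - A) *v x) \<le> \<nu> * norm x * real j powr (\<alpha> - 0)"
            using norm_mult_le_mat_opnorm[of "\<Sum>k=1..j. B k - A" x]
            by (simp add: sum_matrix_vector_mult mult_ac)
        qed (use \<alpha> \<nu>(1) n m in auto)
        also have "\<dots> = 4 * \<nu> * norm x" using n by simp
        also have "\<dots> \<le> \<delta> * \<mu> / 32 * norm x" using \<nu>(2) by (rule mult_right_mono) simp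
        finally show ?thesis .
      qed
      define \<beta> where "\<beta> k = 1 / real k powr \<alpha> * (D * D * trace (B k))" for k
      have "sum \<beta> {n..<m n} \<le> K * \<delta>"
      proof -
        \<comment> \<open>The differences \<open>B i - A\<close> have no sign, so their traces are
          summed with cancellation first; only afterwards is \<open>trace A\<close> added
          back.\<close>
        have "\<bar>\<Sum>i=n..<m n. (1 / real i powr \<alpha>) *\<^sub>R trace (B i - A)\<bar> \<le> 4 * (D * \<nu>) * real n powr (- 0)"
          unfolding real_norm_def[symmetric]
        proof (rule block_sum_bound[where N = N1])
          fix j assume "N1 \<le> j"
          then have "D * mat_opnorm (\<Sum>k=1..j. B k - A) \<le> D * (\<nu> * real j powr \<alpha>)"
            using D by (intro mult_left_mono N1) auto
          then show "norm (\<Sum>i=1..j. trace (B i - A)) \<le> D * \<nu> * real j powr (\<alpha> - 0)"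
            using abs_trace_le_mat_opnorm[of "\<Sum>k=1..j. B k - A"]
            unfolding trace_sum D_def[symmetric] by simp
        qed (use \<alpha> \<nu>(1) n m D in auto)
        then have "(\<Sum>i=n..<m n. (1 / real i powr \<alpha>) *\<^sub>R trace (B i - A)) \<le> \<delta>"
          using \<nu>(3) n by simp
        then have "(\<Sum>i=n..<m n. 1 / real i powr \<alpha> * trace (B i)) \<le> s * trace A + \<delta>"
          by (simp add: trace_sub s_def right_diff_distrib diff_divide_distrib sum_subtractf sum_distrib_right)
        also have "s * trace A \<le> s * (D * a)"
          using abs_trace_le_mat_opnorm[of A] s \<delta>(1) by (intro mult_left_mono) (auto simp: D_def a_def)
        also have "\<dots> \<le> \<delta> * (D * a)" using s D a by (intro mult_right_mono) auto
        finally have "(\<Sum>i=n..<m n. 1 / real i powr \<alpha> * trace (B i)) \<le> \<delta> * (D * a + 1)"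
          by (simp add: distrib_left)
        then have "D * D * (\<Sum>i=n..<m n. 1 / real i powr \<alpha> * trace (B i)) \<le> D * D * (\<delta> * (D * a + 1))"
          using D by (intro mult_left_mono) auto
        then show ?thesis by (simp add: \<beta>_def K_def sum_distrib_left mult_ac)
      qed
      note block = block_growth[where e = e and n = n and m = "m n" and \<beta> = \<beta> and b = "K * \<delta>" and d = d
          and B = "\<lambda>k x. (1 / real k powr \<alpha>) *\<^sub>R (B k *v x)" and g = "\<lambda>k. (1 / real k powr \<alpha>) *\<^sub>R c k"]
        block_linearization[where e = e and n = n and m = "m n" and \<beta> = \<beta> and b = "K * \<delta>" and d = d
          and B = "\<lambda>k x. (1 / real k powr \<alpha>) *\<^sub>R (B k *v x)" and g = "\<lambda>k. (1 / real k powr \<alpha>) *\<^sub>R c k"]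
      have lin: "linear (\<lambda>x. (1 / real k powr \<alpha>) *\<^sub>R (B k *v x))" for k
        by (intro linear_compose_scale_right matrix_vector_mul_linear)
      have bd: "norm ((1 / real k powr \<alpha>) *\<^sub>R (B k *v x)) \<le> \<beta> k * norm x" if "n \<le> k" for k x
      proof -
        have "norm (B k *v x) \<le> D * D * trace (B k) * norm x"
          using norm_mult_le_mat_opnorm[of "B k" x] mat_opnorm_le_trace_psd[OF psd, of k] that n
          unfolding D_def by (meson le_trans mult_right_mono norm_ge_zero order_trans)
        then show ?thesis by (simp add: \<beta>_def divide_right_mono)
      qed
      have \<beta>0: "0 \<le> \<beta> k" if "n \<le> k" for k
        using trace_nonneg_psd[OF psd, of k] that n D by (simp add: \<beta>_def)
      have gd: "norm (\<Sum>i=n..<k. (1 / real i powr \<alpha>) *\<^sub>R c i) \<le> d" if "n \<le> k" "k \<le> m n" for k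
      proof -
        have "norm (\<Sum>i=n..<k. (1 / real i powr \<alpha>) *\<^sub>R c i) \<le> 4 * (\<epsilon> / 16) * real n powr (- \<gamma>)"
          by (rule block_sum_bound[where N = N2]) (use N2 \<alpha> \<gamma> \<epsilon> n m that in auto)
        then show ?thesis by (simp add: d_def)
      qed
      have st: "e (Suc k) = e k + (1 / real k powr \<alpha>) *\<^sub>R c k - (1 / real k powr \<alpha>) *\<^sub>R (B k *v e k)"
        if "n \<le> k" for k
        using step[of k] that n by (simp add: scaleR_diff_right)
      have growth: "norm (e k) \<le> 2 * (norm (e n) + d)" if "n \<le> k" "k \<le> m n" for k
        by (rule block(1)) (use st lin bd \<beta>0 \<open>sum \<beta> {n..<m n} \<le> K * \<delta>\<close> \<delta>(3) gd m that in auto)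
      have lineariz: "norm (e (m n) - (e n - (\<Sum>k=n..<m n. (1 / real k powr \<alpha>) *\<^sub>R (B k *v e n))))
          \<le> 2 * (K * \<delta>)\<^sup>2 * norm (e n) + 2 * d"
        by (rule block(2)) (use st lin bd \<beta>0 \<open>sum \<beta> {n..<m n} \<le> K * \<delta>\<close> \<delta>(3) gd m in auto)
      have "(\<Sum>k=n..<m n. (1 / real k powr \<alpha>) *\<^sub>R (B k *v e n)) = s *\<^sub>R (A *v e n) + R (e n)"
        by (simp add: R_def s_def matrix_vector_mult_diff_rdistrib scaleR_diff_right sum_subtractf scaleR_sum_left)
      \<comment> \<open>Three parts: linearization error, exact gradient step, averaging
        error.\<close>
      then have split: "e (m n) = (e (m n) - (e n - (\<Sum>k=n..<m n. (1 / real k powr \<alpha>) *\<^sub>R (B k *v e n))))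
          + (e n - s *\<^sub>R (A *v e n)) - R (e n)"
        by simp
      have contr: "norm (e n - s *\<^sub>R (A *v e n)) \<le> (1 - \<delta> * \<mu> / 8) * norm (e n)"
      proof -
        have "s * a\<^sup>2 \<le> \<delta> * a\<^sup>2" "s * \<mu> \<le> \<delta> * \<mu>" "\<delta> / 4 * \<mu> \<le> s * \<mu>"
          using s \<mu>(1) by (simp_all add: mult_right_mono)
        then have "norm (e n - s *\<^sub>R (A *v e n)) \<le> (1 - s * \<mu> / 2) * norm (e n)"
          using \<delta> s by (intro gradient_step_contraction \<mu>(2)) (auto simp: a_def)
        also have "\<dots> \<le> (1 - \<delta> * \<mu> / 8) * norm (e n)"
          using \<open>\<delta> / 4 * \<mu> \<le> s * \<mu>\<close> by (intro mult_right_mono) auto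
        finally show ?thesis .
      qed
      have "2 * (K * \<delta>)\<^sup>2 = 64 * K\<^sup>2 * \<delta> * \<delta> / 32" by (simp add: power2_eq_square)
      also have "\<dots> \<le> \<mu> * \<delta> / 32" using \<delta> by (intro divide_right_mono mult_right_mono) auto
      finally have quad: "2 * (K * \<delta>)\<^sup>2 * norm (e n) \<le> \<mu> * \<delta> / 32 * norm (e n)"
        by (rule mult_right_mono) simp
      have "norm (e (m n)) \<le> norm (e (m n) - (e n - (\<Sum>k=n..<m n. (1 / real k powr \<alpha>) *\<^sub>R (B k *v e n))))
          + norm (e n - s *\<^sub>R (A *v e n)) + norm (R (e n))"
        by (subst split) (intro norm_triangle_le_diff add_right_mono norm_triangle_ineq)
      also have "\<dots> \<le> (\<mu> * \<delta> / 32 * norm (e n) + 2 * d) + (1 - \<delta> * \<mu> / 8) * norm (e n) + \<delta> * \<mu> / 32 * norm (e n)"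
        using lineariz quad contr R[of "e n"] by linarith
      also have "\<dots> = \<rho> * norm (e n) + 2 * d" by (simp add: \<rho>_def algebra_simps)
      finally have end_bound: "norm (e (m n)) \<le> \<rho> * norm (e n) + 2 * d" .
      have nd: "real n powr \<gamma> * d = \<epsilon> / 4" using n by (simp add: d_def powr_minus field_simps)
      have d0: "0 \<le> d" using \<epsilon> by (simp add: d_def)
      \<comment> \<open>For \<open>k \<ge> n\<close> the ratio \<open>k / n\<close> is at least 1
        and \<gamma> is below 1, so raising it to the power \<gamma> does not increase it.\<close>
      have ratio: "real k powr \<gamma> \<le> real k / real n * real n powr \<gamma>" if "n \<le> k" for k
      proof -
        have "(real k / real n) powr \<gamma> \<le> (real k / real n) powr 1"
          using that n \<gamma> \<alpha> by (intro powr_mono) auto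
        then have "(real k / real n) powr \<gamma> * real n powr \<gamma> \<le> real k / real n * real n powr \<gamma>"
          using n that by (intro mult_right_mono) auto
        then show ?thesis using n by (simp add: powr_mult[symmetric])
      qed
      have ratio2: "real k powr \<gamma> \<le> 2 * real n powr \<gamma>" if "n \<le> k" "k \<le> m n" for k
      proof -
        have "real k / real n * real n powr \<gamma> \<le> 2 * real n powr \<gamma>"
          using that m n by (intro mult_right_mono) (auto simp: divide_le_eq)
        then show ?thesis using ratio[OF that(1)] by linarith
      qed
      have "real (m n) powr \<gamma> * norm (e (m n)) \<le> real (m n) powr \<gamma> * (\<rho> * norm (e n) + 2 * d)"
        using end_bound by (rule mult_left_mono) simp
      also have "\<dots> = real (m n) powr \<gamma> * (\<rho> * norm (e n)) + real (m n) powr \<gamma> * (2 * d)"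
        by (rule distrib_left)
      \<comment> \<open>Only the contracted term needs the sharp ratio of block ends; for the drive
        the crude factor 2 suffices.\<close>
      also have "\<dots> \<le> (1 + (1 - \<rho>) / 2) * real n powr \<gamma> * (\<rho> * norm (e n)) + 2 * real n powr \<gamma> * (2 * d)"
      proof (intro add_mono mult_right_mono)
        have "real (m n) / real n * real n powr \<gamma> \<le> (1 + (1 - \<rho>) / 2) * real n powr \<gamma>"
          using m n by (intro mult_right_mono) (auto simp: divide_le_eq)
        then show "real (m n) powr \<gamma> \<le> (1 + (1 - \<rho>) / 2) * real n powr \<gamma>"
          using ratio[of "m n"] m by linarith
      qed (use ratio2[of "m n"] m \<rho> d0 in auto)
      also have "2 * real n powr \<gamma> * (2 * d) = \<epsilon>" using nd by simp
      also have "(1 + (1 - \<rho>) / 2) * real n powr \<gamma> * (\<rho> * norm (e n)) =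
          (1 + (1 - \<rho>) / 2) * \<rho> * (real n powr \<gamma> * norm (e n))" by simp
      also have "\<dots> \<le> (1 + \<rho>) / 2 * (real n powr \<gamma> * norm (e n))"
      proof (rule mult_right_mono)
        have "(1 + \<rho>) / 2 - (1 + (1 - \<rho>) / 2) * \<rho> = (1 - \<rho>)\<^sup>2 / 2"
          by (simp add: power2_eq_square field_simps)
        then show "(1 + (1 - \<rho>) / 2) * \<rho> \<le> (1 + \<rho>) / 2"
          using zero_le_power2[of "1 - \<rho>"] by linarith
      qed simp
      finally have "real (m n) powr \<gamma> * norm (e (m n)) \<le> (1 + \<rho>) / 2 * (real n powr \<gamma> * norm (e n)) + \<epsilon>"
        by simp
      moreover have "real k powr \<gamma> * norm (e k) \<le> 4 * (real n powr \<gamma> * norm (e n) + \<epsilon>)"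
        if "n \<le> k" "k \<le> m n" for k
      proof -
        have "real k powr \<gamma> * norm (e k) \<le> 2 * real n powr \<gamma> * (2 * (norm (e n) + d))"
          using that by (intro mult_mono ratio2 growth) auto
        also have "\<dots> = 4 * (real n powr \<gamma> * norm (e n) + real n powr \<gamma> * d)"
          by (simp add: distrib_left)
        also have "\<dots> \<le> 4 * (real n powr \<gamma> * norm (e n) + \<epsilon>)" using nd \<epsilon> by simp
        finally show ?thesis .
      qed
      ultimately show ?case using m by simp
    qed
  qed (use \<rho> in auto)
qed

section \<open>Centering at \<open>h\<close> and combining both directions\<close>

theorem theorem1:
  fixes chi gamma :: real
    and Abar :: "nat \<Rightarrow> real ^ 'd ^ 'd"
    and bbar hbar :: "nat \<Rightarrow> real ^ 'd"
    and A :: "real ^ 'd ^ 'd"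
    and h :: "real ^ 'd"
  assumes chi_range: "0 < chi" "chi < 1"
    and gamma_range: "0 \<le> gamma" "gamma < chi"
    and Abar_psd: "\<And>k. k \<ge> 1 \<Longrightarrow> sym_pos_semidef (Abar k)"
    and A_pd: "sym_pos_def A"
    and rec: "\<And>k. k \<ge> 1 \<Longrightarrow>
      hbar (k + 1) = hbar k + (1 / real k powr chi) *\<^sub>R (bbar k - Abar k *v hbar k)"
  shows "(((\<lambda>n. mat_opnorm ((1 / real n powr chi) *\<^sub>R (\<Sum>k=1..n. Abar k - A))) \<longlonglongrightarrow> 0)
          \<and> ((\<lambda>n. norm ((1 / real n powr (chi - gamma)) *\<^sub>R (\<Sum>k=1..n. bbar k - Abar k *v h))) \<longlonglongrightarrow> 0)
          \<longrightarrow> (\<lambda>n. norm (hbar n - h)) \<in> o(\<lambda>n. real n powr (- gamma)))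
       \<and> (((\<lambda>k. norm ((real k powr (1 - chi)) *\<^sub>R (hbar k - h))) \<longlonglongrightarrow> 0)
          \<and> bounded ((\<lambda>n. (1 / real n powr chi) * (\<Sum>k=1..n. real k powr (chi - 1) * mat_opnorm (Abar k))) ` {1..})
          \<longrightarrow> (\<lambda>n. norm ((1 / real n powr chi) *\<^sub>R (\<Sum>k=1..n. bbar k - Abar k *v h))) \<longlonglongrightarrow> 0)"
proof -
  define e where "e k = hbar k - h" for k
  define c where "c k = bbar k - Abar k *v h" for k
  have step: "e (Suc k) = e k + (1 / real k powr chi) *\<^sub>R (c k - Abar k *v e k)" if "1 \<le> k" for k
    using rec[OF that] by (simp add: e_def c_def matrix_vector_mult_diff_distrib)
  show ?thesis
    unfolding c_def[symmetric] e_def[symmetric]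
  proof (intro conjI impI; elim conjE)
    assume B: "(\<lambda>n. mat_opnorm ((1 / real n powr chi) *\<^sub>R (\<Sum>k=1..n. Abar k - A))) \<longlonglongrightarrow> 0"
      and c: "(\<lambda>n. norm ((1 / real n powr (chi - gamma)) *\<^sub>R (\<Sum>k=1..n. c k))) \<longlonglongrightarrow> 0"
    have "(\<lambda>n. real n powr gamma * norm (e n)) \<longlonglongrightarrow> 0"
      by (rule stochastic_approximation_rate[OF chi_range gamma_range Abar_psd A_pd step])
        (use B c in \<open>simp_all add: mat_opnorm_scaleR\<close>)
    moreover have "\<forall>\<^sub>F n in sequentially. real n powr gamma * norm (e n) = norm (e n) / real n powr (- gamma)"
      using eventually_gt_at_top[of 0] by eventually_elim (simp add: powr_minus field_simps)
    ultimately have "(\<lambda>n. norm (e n) / real n powr (- gamma)) \<longlonglongrightarrow> 0"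
      by (rule Lim_transform_eventually)
    moreover have "\<forall>\<^sub>F n in sequentially. real n powr (- gamma) \<noteq> 0"
      using eventually_gt_at_top[of 0] by eventually_elim simp
    ultimately show "(\<lambda>n. norm (e n)) \<in> o(\<lambda>n. real n powr (- gamma))"
      by (intro smalloI_tendsto)
  next
    assume e: "(\<lambda>k. norm ((real k powr (1 - chi)) *\<^sub>R e k)) \<longlonglongrightarrow> 0"
      and B: "bounded ((\<lambda>n. (1 / real n powr chi) * (\<Sum>k=1..n. real k powr (chi - 1) * mat_opnorm (Abar k))) ` {1..})"
    have "(\<lambda>n. (1 / real n powr chi) *\<^sub>R (\<Sum>k=1..n. c k)) \<longlonglongrightarrow> 0"
      by (rule averaged_driving_term_tendsto_0[OF chi_range step _ B]) (use e in simp_all)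
    then show "(\<lambda>n. norm ((1 / real n powr chi) *\<^sub>R (\<Sum>k=1..n. c k))) \<longlonglongrightarrow> 0"
      by (rule tendsto_norm_zero)
  qed
qed

end
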